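(* Let $D=\{(x,y)\in\mathbb{Z}^2 \mid \max\{x,0\}\le y\}$ and let $H:D\to\mathbb{R}$. Then $\{H(Z_t,M_t)\}_{t=0}^\infty$ is a martingale with respect to $(\mathcal{F}_t)_{t\ge 0}$ if and only if there exists a function $F:\mathbb{Z}_{\ge 0}\to\mathbb{R}$ such that for all $(x,y)\in D$ $$H(x,y)=\begin{cases} F(y)-\{F(y+1)-F(y)\}(y-x), & \text{if } p=q,\\[4pt] F(y)-\{F(y+1)-F(y)\}\,\dfrac{(q/p)^{-(y-x)}-1}{1-q/p}, & \text{if } p\ne q.\end{cases}$$
   Context: $\mathbb{Z}_{\ge 0}$ denotes the set of nonnegative integers. Let $\xi_1,\xi_2,\dots$ be i.i.d. random variables on a probability space $(\Omega,\mathcal{F},P)$ with $P(\xi_1=1)=p$, $P(\xi_1=-1)=q$, $P(\xi_1=0)=r$, where $p>0$, $q>0$ (and $r\ge 0$), $p+q+r=1$. The random walk is $Z_0=0$, $Z_{t+1}=Z_t+\xi_{t+1}$ for $t\in\mathbb{Z}_{\ge 0}$, its maximum process is $M_t=\max_{0\le s\le t}Z_s$, and the filtration is the natural one, $\mathcal{F}_t=\sigma(Z_s: s\le t)$. *)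

theory Defs
  imports "HOL-Probability.Probability"
begin

definition natural_filtration ::
    "'a measure \<Rightarrow> 'b measure \<Rightarrow> (nat \<Rightarrow> 'a \<Rightarrow> 'b) \<Rightarrow> nat \<Rightarrow> 'a measure" where
  "natural_filtration M N X t =
     sigma (space M) (\<Union>s\<in>{..t}. {X s -` A \<inter> space M | A. A \<in> sets N})"

(* sigma_finite_subalgebra M (F t) says that F t is a sub-sigma-algebra of M on which M stays
   sigma-finite, as real_cond_exp requires; the latter is automatic for finite M. *)
definition martingale ::
    "'a measure \<Rightarrow> (nat \<Rightarrow> 'a measure) \<Rightarrow> (nat \<Rightarrow> 'a \<Rightarrow> real) \<Rightarrow> bool" where
  "martingale M F X \<longleftrightarrow>
     filtration (space M) F \<and>
     (\<forall>t. sigma_finite_subalgebra M (F t)) \<and>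
     (\<forall>t. X t \<in> borel_measurable (F t)) \<and>
     (\<forall>t. integrable M (X t)) \<and>
     (\<forall>s t. s \<le> t \<longrightarrow> (AE \<omega> in M. real_cond_exp M (F s) (X t) \<omega> = X s \<omega>))"

(* The steps are indexed from 1: \<xi> 0 is never used. *)
primrec walk :: "(nat \<Rightarrow> 'a \<Rightarrow> int) \<Rightarrow> nat \<Rightarrow> 'a \<Rightarrow> int" where
  "walk \<xi> 0 \<omega> = 0"
| "walk \<xi> (Suc t) \<omega> = walk \<xi> t \<omega> + \<xi> (Suc t) \<omega>"

definition walk_max :: "(nat \<Rightarrow> 'a \<Rightarrow> int) \<Rightarrow> nat \<Rightarrow> 'a \<Rightarrow> int" where
  "walk_max \<xi> t \<omega> = (MAX s\<in>{..t}. walk \<xi> s \<omega>)"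

definition D :: "(int \<times> int) set" where
  "D = {(x, y). max x 0 \<le> y}"

(* Hence a function on D may be represented by a total function on int * int:
   its values outside D play no role along the process. *)
lemma walk_walk_max_in_D: "(walk \<xi> t \<omega>, walk_max \<xi> t \<omega>) \<in> D"
proof -
  have le: "walk \<xi> s \<omega> \<le> walk_max \<xi> t \<omega>" if "s \<le> t" for s
    unfolding walk_max_def using that by (intro Max_ge) auto
  from le[of 0] le[of t] show ?thesis
    by (simp add: D_def)
qed

end

theory Submission
  imports Defs
begin

text \<open>
  The pair \<open>(Z, M)\<close> is a Markov chain on \<open>D\<close>: from \<open>(x, y)\<close> a step \<open>e\<close> leads to
  \<open>(x + e, max y (x + e))\<close>.  Writing \<open>T H (x, y)\<close> for the average of \<open>H\<close> over the three possible
  next states, independence of \<open>\<xi> (t + 1)\<close> from the past gives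
  \<open>E[H (Z (t + 1), M (t + 1)) | F t] = T H (Z t, M t)\<close> (lemma \<open>cond_exp_one_step\<close>).
  There is no integrability issue, since at a fixed time the chain takes, almost surely,
  only finitely many values.
  Hence \<open>T H = H\<close> on \<open>D\<close> implies the martingale property.  Conversely, a martingale satisfies
  \<open>T H = H\<close> at every state visited with positive probability, and every \<open>(x, y) \<in> D\<close> is such a
  state: take \<open>y\<close> steps up and then \<open>y - x\<close> steps down (lemma \<open>prob_state_pos\<close>).

  It remains to solve \<open>T H = H\<close> on \<open>D\<close>, which is deterministic (lemma \<open>harmonic_iff\<close>).
  Put \<open>F y = H (y, y)\<close>.  On a fixed level \<open>y\<close>, the equation says that the difference
  \<open>H (y - k, y) - H (y - k - 1, y)\<close> is \<open>p / q\<close> times the difference one step closer to the maximum,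
  where on the diagonal the previous difference is \<open>F (y + 1) - F y\<close>.  So these differences form a
  geometric progression, and
  \<open>H (y - k, y) = F y - (F (y + 1) - F y) * (\<Sum>j=1..k. (p / q) ^ j)\<close>.
  Both cases of the theorem are closed forms of this geometric sum.
\<close>

section \<open>The harmonic functions of the walk and its maximum\<close>

definition advance :: "int \<times> int \<Rightarrow> int \<Rightarrow> int \<times> int" where
  "advance z e = (fst z + e, max (snd z) (fst z + e))"

definition step_mean :: "real \<Rightarrow> real \<Rightarrow> real \<Rightarrow> (int \<times> int \<Rightarrow> real) \<Rightarrow> int \<times> int \<Rightarrow> real" where
  "step_mean p q r H z = p * H (advance z 1) + q * H (advance z (- 1)) + r * H (advance z 0)"

text \<open>
  Points of \<open>D\<close> are parametrised by the level \<open>n\<close> of the maximum and the distance \<open>k\<close> below it,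
  which turns the recursion along a level into an induction on \<open>k\<close>.
\<close>

lemma ball_D_iff: "(\<forall>z\<in>D. Q z) \<longleftrightarrow> (\<forall>n k. Q (int n - int k, int n))"
proof (intro iffI allI ballI)
  fix z assume Q: "\<forall>n k. Q (int n - int k, int n)" and "z \<in> D"
  then obtain x y where z: "z = (x, y)" "x \<le> y" "0 \<le> y"
    by (auto simp: D_def)
  with Q[rule_format, of "nat y" "nat (y - x)"] show "Q z"
    by simp
qed (auto simp: D_def)

lemma step_mean_diagonal:
  "step_mean p q r H (int n, int n) =
     p * H (int (Suc n), int (Suc n)) + q * H (int n - 1, int n) + r * H (int n, int n)"
  by (simp add: step_mean_def advance_def max_def ac_simps)

lemma step_mean_below_diagonal:
  "step_mean p q r H (int n - int (Suc k), int n) =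
     p * H (int n - int k, int n) + q * H (int n - int (Suc (Suc k)), int n)
     + r * H (int n - int (Suc k), int n)"
  by (simp add: step_mean_def advance_def max_def algebra_simps)

text \<open>
  On level \<open>n\<close>, \<open>step_mean p q r H = H\<close> reads \<open>q * (H k - H (k + 1)) = p * (H (k - 1) - H k)\<close>, where \<open>H k\<close>
  is the value at distance \<open>k\<close> from the maximum.  At \<open>k = 0\<close> a step up raises the maximum,
  and \<open>H (- 1)\<close> stands for the diagonal value \<open>F (n + 1)\<close> on the next level; this is how the levels
  are coupled.
\<close>

lemma harmonic_iff:
  assumes "p > 0" "q > 0" and pqr: "p + q + r = 1"
  shows "(\<forall>z\<in>D. step_mean p q r H z = H z) \<longleftrightarrow>
    (\<exists>F :: nat \<Rightarrow> real. \<forall>n k.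
       H (int n - int k, int n) = F n - (F (Suc n) - F n) * (\<Sum>j=1..k. (p / q) ^ j))"
    (is "?harmonic \<longleftrightarrow> (\<exists>F. \<forall>n k. ?form F n k)")
proof
  assume harm: ?harmonic
  define F where "F n = H (int n, int n)" for n
  have r: "r = 1 - p - q"
    using pqr by simp
  have diff: "H (int n - int k, int n) - H (int n - int (Suc k), int n)
              = (p / q) ^ Suc k * (F (Suc n) - F n)" for n k
  proof (induction k)
    case 0
    have "step_mean p q r H (int n, int n) = H (int n, int n)"
      using harm by (auto simp: D_def)
    then have "q * (F n - H (int n - 1, int n)) = p * (F (Suc n) - F n)"
      by (simp add: step_mean_diagonal F_def r algebra_simps)
    then show ?case
      using \<open>q > 0\<close> by (simp add: F_def field_simps)
  next
    case (Suc k)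
    have "step_mean p q r H (int n - int (Suc k), int n) = H (int n - int (Suc k), int n)"
      using harm by (auto simp: D_def)
    then have "q * (H (int n - int (Suc k), int n) - H (int n - int (Suc (Suc k)), int n))
               = p * (H (int n - int k, int n) - H (int n - int (Suc k), int n))"
      unfolding step_mean_below_diagonal by (simp only: r) (simp add: algebra_simps)
    also have "\<dots> = p * ((p / q) ^ Suc k * (F (Suc n) - F n))"
      by (simp only: Suc)
    finally show ?case
      using \<open>q > 0\<close> by (simp add: field_simps)
  qed
  have "?form F n k" for n k
  proof (induction k)
    case 0
    then show ?case by (simp add: F_def)
  next
    case (Suc k)
    have "H (int n - int (Suc k), int n)
          = H (int n - int k, int n) - (p / q) ^ Suc k * (F (Suc n) - F n)"
      using diff[of n k] by simp
    then show ?case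
      unfolding Suc by (simp add: algebra_simps)
  qed
  then show "\<exists>F. \<forall>n k. ?form F n k"
    by blast
next
  assume "\<exists>F. \<forall>n k. ?form F n k"
  then obtain F where form: "\<And>n k. ?form F n k"
    by blast
  have r: "r = 1 - p - q"
    using pqr by simp
  have diagonal: "H (int n, int n) = F n" for n
    using form[of n 0] by simp
  have "step_mean p q r H (int n - int k, int n) = H (int n - int k, int n)" for n k
  proof (cases k)
    case 0
    have "H (int n - 1, int n) = F n - (F (Suc n) - F n) * (p / q)"
      using form[of n 1] by simp
    then show ?thesis
      using \<open>q > 0\<close> unfolding 0 of_nat_0 diff_0_right step_mean_diagonal
      by (simp only: diagonal r) (simp add: field_simps)
  next
    case (Suc j)
    then show ?thesis
      using \<open>q > 0\<close> unfolding Suc step_mean_below_diagonal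
      by (simp only: form r) (simp add: field_simps)
  qed
  then show ?harmonic
    by (simp add: ball_D_iff)
qed

lemma geometric_sum_closed_form:
  fixes p q :: real
  assumes "p > 0" "q > 0"
  shows "(\<Sum>j=1..k. (p / q) ^ j) =
    (if p = q then real k else ((q / p) powi (- int k) - 1) / (1 - q / p))"
proof (cases "p = q")
  case False
  have sum: "(\<Sum>j=1..k. a ^ j) = (a ^ k - 1) / (1 - inverse a)" if "a \<noteq> 0" "a \<noteq> 1" for a :: real
    using that by (induction k) (simp_all add: field_simps)
  have "(\<Sum>j=1..k. (p / q) ^ j) = ((p / q) ^ k - 1) / (1 - q / p)"
    using sum[of "p / q"] assms False by simp
  then show ?thesis
    using False by (simp add: power_int_minus power_divide)
qed (use assms in simp)

section \<open>Natural filtrations\<close>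

lemma space_natural_filtration [simp]: "space (natural_filtration M N X t) = space M"
  by (simp add: natural_filtration_def space_measure_of_conv)

lemma sets_natural_filtration:
  "sets (natural_filtration M N X t) =
     sigma_sets (space M) (\<Union>s\<in>{..t}. {X s -` A \<inter> space M | A. A \<in> sets N})"
  unfolding natural_filtration_def by (intro sets_measure_of) auto

lemma measurable_natural_filtration:
  assumes "s \<le> t" and "X s \<in> space M \<rightarrow> space N"
  shows "X s \<in> natural_filtration M N X t \<rightarrow>\<^sub>M N"
proof (rule measurableI)
  fix A assume "A \<in> sets N"
  then show "X s -` A \<inter> space (natural_filtration M N X t) \<in> sets (natural_filtration M N X t)"
    using assms(1) by (auto simp: sets_natural_filtration intro!: sigma_sets.Basic)
qed (use assms(2) in auto)

lemma natural_filtration_least: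
  assumes "space V = space M" and "\<And>s. s \<le> t \<Longrightarrow> X s \<in> V \<rightarrow>\<^sub>M N"
  shows "sets (natural_filtration M N X t) \<subseteq> sets V"
proof -
  have "X s -` A \<inter> space M \<in> sets V" if "s \<le> t" "A \<in> sets N" for s A
    using measurable_sets[OF assms(2)[OF that(1)] that(2)] by (simp add: assms(1))
  then show ?thesis
    unfolding sets_natural_filtration assms(1)[symmetric]
    by (intro sets.sigma_sets_subset) (auto simp: assms(1))
qed

lemma filtration_natural_filtration: "filtration (space M) (natural_filtration M N X)"
proof
  fix i j :: nat assume "i \<le> j"
  then show "sets (natural_filtration M N X i) \<subseteq> sets (natural_filtration M N X j)"
    unfolding sets_natural_filtration by (intro sigma_sets_mono' UN_mono) auto
qed simp

section \<open>The walk and its maximum as a Markov chain\<close>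

lemma sets_eq_value:
  assumes "f \<in> N \<rightarrow>\<^sub>M count_space UNIV"
  shows "{\<omega> \<in> space N. f \<omega> = c} \<in> sets N"
proof -
  have "{\<omega> \<in> space N. f \<omega> = c} = f -` {c} \<inter> space N"
    by auto
  then show ?thesis
    using measurable_sets[OF assms, of "{c}"] by simp
qed

lemma measurable_Pair_count_space:
  fixes f :: "'a \<Rightarrow> 'b::countable" and g :: "'a \<Rightarrow> 'c::countable"
  assumes "f \<in> M \<rightarrow>\<^sub>M count_space UNIV" "g \<in> M \<rightarrow>\<^sub>M count_space UNIV"
  shows "(\<lambda>\<omega>. (f \<omega>, g \<omega>)) \<in> M \<rightarrow>\<^sub>M count_space UNIV"
  using measurable_Pair[OF assms] by (simp add: pair_measure_countable)

lemma measurable_count_space_binary: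
  fixes f :: "'a \<Rightarrow> 'b::countable" and g :: "'a \<Rightarrow> 'c::countable"
  assumes "f \<in> M \<rightarrow>\<^sub>M count_space UNIV" "g \<in> M \<rightarrow>\<^sub>M count_space UNIV"
  shows "(\<lambda>\<omega>. h (f \<omega>) (g \<omega>)) \<in> M \<rightarrow>\<^sub>M count_space UNIV"
  using measurable_compose[OF measurable_Pair_count_space[OF assms], of "case_prod h" "count_space UNIV"]
  by simp

definition state :: "(nat \<Rightarrow> 'a \<Rightarrow> int) \<Rightarrow> nat \<Rightarrow> 'a \<Rightarrow> int \<times> int" where
  "state \<xi> t \<omega> = (walk \<xi> t \<omega>, walk_max \<xi> t \<omega>)"

lemma state_0: "state \<xi> 0 \<omega> = (0, 0)"
  by (simp add: state_def walk_max_def)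

lemma state_Suc: "state \<xi> (Suc t) \<omega> = advance (state \<xi> t \<omega>) (\<xi> (Suc t) \<omega>)"
  by (simp add: state_def walk_max_def advance_def atMost_Suc max.commute)

lemma state_in_D: "state \<xi> t \<omega> \<in> D"
  by (simp add: state_def walk_walk_max_in_D)

lemma measurable_state:
  assumes "\<And>s. s \<le> t \<Longrightarrow> walk \<xi> s \<in> V \<rightarrow>\<^sub>M count_space UNIV"
  shows "state \<xi> t \<in> V \<rightarrow>\<^sub>M count_space UNIV"
  using assms
proof (induction t)
  case 0
  then show ?case by (simp add: state_0)
next
  case (Suc t)
  have "state \<xi> (Suc t) = (\<lambda>\<omega>. (walk \<xi> (Suc t) \<omega>, max (snd (state \<xi> t \<omega>)) (walk \<xi> (Suc t) \<omega>)))"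
    by (simp add: fun_eq_iff state_Suc advance_def) (simp add: state_def)
  also have "\<dots> \<in> V \<rightarrow>\<^sub>M count_space UNIV"
  proof (rule measurable_count_space_binary[where h = "\<lambda>z w. (w, max (snd z) w)"])
    show "state \<xi> t \<in> V \<rightarrow>\<^sub>M count_space UNIV"
      by (rule Suc.IH, rule Suc.prems) simp
    show "walk \<xi> (Suc t) \<in> V \<rightarrow>\<^sub>M count_space UNIV"
      by (rule Suc.prems) simp
  qed
  finally show ?case .
qed

locale lazy_walk = prob_space M for M :: "'a measure" +
  fixes \<xi> :: "nat \<Rightarrow> 'a \<Rightarrow> int" and p q r :: real
  assumes p_pos: "p > 0" and q_pos: "q > 0" and pqr: "p + q + r = 1"
    and indep_steps: "indep_vars (\<lambda>_. count_space UNIV) \<xi> {1..}"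
    and prob_up: "\<And>i. i \<ge> 1 \<Longrightarrow> prob {\<omega> \<in> space M. \<xi> i \<omega> = 1} = p"
    and prob_down: "\<And>i. i \<ge> 1 \<Longrightarrow> prob {\<omega> \<in> space M. \<xi> i \<omega> = - 1} = q"
    and prob_stay: "\<And>i. i \<ge> 1 \<Longrightarrow> prob {\<omega> \<in> space M. \<xi> i \<omega> = 0} = r"
begin

abbreviation \<F> :: "nat \<Rightarrow> 'a measure" where
  "\<F> \<equiv> natural_filtration M (count_space UNIV) (walk \<xi>)"

lemma measurable_step: "i \<ge> 1 \<Longrightarrow> \<xi> i \<in> M \<rightarrow>\<^sub>M count_space UNIV"
  using indep_steps unfolding indep_vars_def by simp

lemma measurable_walk:
  assumes "\<And>i. i \<in> {1..t} \<Longrightarrow> \<xi> i \<in> V \<rightarrow>\<^sub>M count_space UNIV" and "s \<le> t"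
  shows "walk \<xi> s \<in> V \<rightarrow>\<^sub>M count_space UNIV"
  using assms(2)
proof (induction s)
  case 0
  have "walk \<xi> 0 = (\<lambda>_. 0)"
    by auto
  then show ?case by simp
next
  case (Suc s)
  have "walk \<xi> (Suc s) = (\<lambda>\<omega>. walk \<xi> s \<omega> + \<xi> (Suc s) \<omega>)"
    by auto
  also have "\<dots> \<in> V \<rightarrow>\<^sub>M count_space UNIV"
  proof (rule measurable_count_space_binary[where h = "(+)"])
    show "walk \<xi> s \<in> V \<rightarrow>\<^sub>M count_space UNIV"
      using Suc by simp
    show "\<xi> (Suc s) \<in> V \<rightarrow>\<^sub>M count_space UNIV"
      using Suc.prems by (intro assms(1)) simp
  qed
  finally show ?case .
qed

lemma subalgebra_filtration: "subalgebra M (\<F> t)"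
proof -
  have "walk \<xi> s \<in> M \<rightarrow>\<^sub>M count_space UNIV" if "s \<le> t" for s
    using measurable_walk[OF measurable_step that] by simp
  then show ?thesis
    by (simp add: subalgebra_def natural_filtration_least)
qed

lemma sigma_finite_subalgebra_filtration: "sigma_finite_subalgebra M (\<F> t)"
proof -
  interpret finite_measure_subalgebra M "\<F> t"
    by unfold_locales (rule subalgebra_filtration)
  show ?thesis
    by (rule sigma_finite_subalgebra_axioms)
qed

lemma measurable_state_filtration: "state \<xi> t \<in> \<F> t \<rightarrow>\<^sub>M count_space UNIV"
proof (rule measurable_state)
  show "walk \<xi> s \<in> \<F> t \<rightarrow>\<^sub>M count_space UNIV" if "s \<le> t" for s
    using that by (rule measurable_natural_filtration) simp
qed

lemma borel_measurable_state:
  "(\<lambda>\<omega>. G (state \<xi> t \<omega>)) \<in> borel_measurable (\<F> t)"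
  by (rule measurable_compose[OF measurable_state_filtration]) simp

lemma AE_step_cases: "i \<ge> 1 \<Longrightarrow> AE \<omega> in M. \<xi> i \<omega> \<in> {1, - 1, 0}"
proof -
  assume i: "i \<ge> 1"
  have ev: "{\<omega> \<in> space M. \<xi> i \<omega> = e} \<in> events" for e
    by (rule sets_eq_value[OF measurable_step[OF i]])
  let ?E = "\<lambda>e. {\<omega> \<in> space M. \<xi> i \<omega> = e}"
  have "prob (?E 1 \<union> ?E (- 1) \<union> ?E 0) = prob (?E 1 \<union> ?E (- 1)) + prob (?E 0)"
    by (intro finite_measure_Union sets.Un ev) auto
  also have "prob (?E 1 \<union> ?E (- 1)) = prob (?E 1) + prob (?E (- 1))"
    by (intro finite_measure_Union ev) auto
  finally have "prob (?E 1 \<union> ?E (- 1) \<union> ?E 0) = 1"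
    using prob_up[OF i] prob_down[OF i] prob_stay[OF i] pqr by simp
  then have "AE \<omega> in M. \<omega> \<in> ?E 1 \<union> ?E (- 1) \<union> ?E 0"
    by (rule AE_prob_1)
  then show ?thesis
    by eventually_elim auto
qed

text \<open>
  Finiteness of this range is what makes every real function of the state integrable.
\<close>

lemma AE_state_bounded: "AE \<omega> in M. state \<xi> t \<omega> \<in> {- int t..int t} \<times> {0..int t}"
proof (induction t)
  case 0
  then show ?case by (simp add: state_0)
next
  case (Suc t)
  from Suc AE_step_cases[of "Suc t", simplified] show ?case
    by eventually_elim (auto simp: state_Suc advance_def)
qed

lemma integrable_state: "integrable M (\<lambda>\<omega>. G (state \<xi> t \<omega>) :: real)"
proof (rule integrable_const_bound)
  let ?B = "{- int t..int t} \<times> {0..int t}"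
  show "AE \<omega> in M. norm (G (state \<xi> t \<omega>)) \<le> Max ((\<lambda>z. norm (G z)) ` ?B)"
    using AE_state_bounded[of t] by eventually_elim (intro Max_ge, simp_all)
  show "(\<lambda>\<omega>. G (state \<xi> t \<omega>)) \<in> borel_measurable M"
    by (rule measurable_from_subalg[OF subalgebra_filtration borel_measurable_state])
qed

definition steps_algebra :: "nat set \<Rightarrow> 'a measure" where
  "steps_algebra I =
     vimage_algebra (space M) (\<lambda>\<omega>. restrict (\<lambda>i. \<xi> i \<omega>) I) (PiM I (\<lambda>_. count_space UNIV))"

lemma space_steps_algebra [simp]: "space (steps_algebra I) = space M"
  by (simp add: steps_algebra_def)

lemma measurable_steps_algebra:
  assumes "i \<in> I"
  shows "\<xi> i \<in> steps_algebra I \<rightarrow>\<^sub>M count_space UNIV"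
proof -
  have "(\<lambda>\<omega>. restrict (\<lambda>i. \<xi> i \<omega>) I) \<in> steps_algebra I \<rightarrow>\<^sub>M PiM I (\<lambda>_. count_space UNIV)"
    unfolding steps_algebra_def by (rule measurable_vimage_algebra1) (auto simp: space_PiM)
  from measurable_compose[OF this measurable_component_singleton[OF assms]] assms
  show ?thesis by simp
qed

lemma indep_steps_algebra:
  assumes "I \<inter> J = {}" "I \<subseteq> {1..}" "J \<subseteq> {1..}"
  shows "indep_set (sets (steps_algebra I)) (sets (steps_algebra J))"
  using indep_var_restrict[OF indep_steps assms]
  unfolding indep_var_eq steps_algebra_def sets_vimage_algebra by blast

text \<open>
  Independence of the next step is needed for arbitrary integrands known at time \<open>t\<close>.
  The filtration is generated by the walk, whereas independence is given for the steps.  The bridge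
  is that \<open>\<F> t\<close> lies in the sigma-algebra generated by the steps \<open>1..t\<close>, which is independent of step
  \<open>t + 1\<close>.
\<close>

lemma indep_next_step:
  fixes U :: "'a \<Rightarrow> real"
  assumes U: "U \<in> borel_measurable (\<F> t)"
  shows "indep_var borel U borel (\<lambda>\<omega>. indicator {e} (\<xi> (Suc t) \<omega>) :: real)"
proof -
  let ?I = "\<lambda>\<omega>. indicator {e} (\<xi> (Suc t) \<omega>) :: real"
  let ?gen = "\<lambda>X :: 'a \<Rightarrow> real. sigma_sets (space M) {X -` A \<inter> space M | A. A \<in> sets borel}"
  have gen: "?gen X \<subseteq> sets V" if "X \<in> borel_measurable V" "space V = space M" for X V
  proof -
    have "{X -` A \<inter> space M | A. A \<in> sets borel} \<subseteq> sets V"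
      using measurable_sets[OF that(1)] that(2) by auto
    then show ?thesis
      using sets.sigma_sets_subset[of _ V] that(2) by simp
  qed
  have "sets (\<F> t) \<subseteq> sets (steps_algebra {1..t})"
  proof (rule natural_filtration_least)
    show "walk \<xi> s \<in> steps_algebra {1..t} \<rightarrow>\<^sub>M count_space UNIV" if "s \<le> t" for s
      using measurable_walk[OF measurable_steps_algebra that] by simp
  qed simp
  then have U_past: "?gen U \<subseteq> sets (steps_algebra {1..t})"
    using gen[OF U] by simp
  have "?I \<in> borel_measurable (steps_algebra {Suc t})"
    by (rule measurable_compose[OF measurable_steps_algebra]) simp_all
  then have I_next: "?gen ?I \<subseteq> sets (steps_algebra {Suc t})"
    using gen by simp
  have "indep_set (sets (steps_algebra {1..t})) (sets (steps_algebra {Suc t}))"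
    by (rule indep_steps_algebra) auto
  then have "indep_set (?gen U) (?gen ?I)"
    using U_past I_next unfolding indep_sets2_eq by blast
  moreover have "random_variable borel U"
    by (rule measurable_from_subalg[OF subalgebra_filtration U])
  moreover have "random_variable borel ?I"
    by (rule measurable_compose[OF measurable_step]) simp_all
  ultimately show ?thesis
    unfolding indep_var_eq by blast
qed

lemma integrable_mult_step:
  fixes U :: "'a \<Rightarrow> real"
  assumes "integrable M U"
  shows "integrable M (\<lambda>\<omega>. U \<omega> * indicator {e} (\<xi> (Suc t) \<omega>))"
proof (rule Bochner_Integration.integrable_bound[OF assms])
  have "(\<lambda>\<omega>. indicator {e} (\<xi> (Suc t) \<omega>) :: real) \<in> borel_measurable M"
    by (rule measurable_compose[OF measurable_step]) simp_all
  then show "(\<lambda>\<omega>. U \<omega> * indicator {e} (\<xi> (Suc t) \<omega>)) \<in> borel_measurable M"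
    using assms by simp
qed (auto simp: indicator_def)

lemma expectation_mult_step:
  fixes U :: "'a \<Rightarrow> real"
  assumes U: "U \<in> borel_measurable (\<F> t)" and int: "integrable M U"
  shows "expectation (\<lambda>\<omega>. U \<omega> * indicator {e} (\<xi> (Suc t) \<omega>)) =
         expectation U * prob {\<omega> \<in> space M. \<xi> (Suc t) \<omega> = e}"
proof -
  have I: "integrable M (\<lambda>\<omega>. indicator {e} (\<xi> (Suc t) \<omega>) :: real)"
    using integrable_mult_step[of "\<lambda>_. 1" e t] by simp
  have "expectation (\<lambda>\<omega>. indicator {e} (\<xi> (Suc t) \<omega>) :: real) =
        expectation (indicator {\<omega> \<in> space M. \<xi> (Suc t) \<omega> = e})"
    by (intro Bochner_Integration.integral_cong) (auto simp: indicator_def)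
  also have "\<dots> = prob {\<omega> \<in> space M. \<xi> (Suc t) \<omega> = e}"
    by (simp add: Int_absorb2 subset_eq)
  finally show ?thesis
    using indep_var_lebesgue_integral[OF indep_next_step[OF U] int I] by simp
qed

text \<open>
  On each of the events \<open>\<xi> (t + 1) = e\<close>, which exhaust the space almost surely, the next state is
  \<open>advance (state t) e\<close>, a function of the past.  Integrating over an event of \<open>\<F> t\<close> therefore splits
  into three expectations, each of which factorises by independence.
\<close>

lemma cond_exp_one_step:
  fixes G :: "int \<times> int \<Rightarrow> real"
  shows "AE \<omega> in M. real_cond_exp M (\<F> t) (\<lambda>\<omega>. G (state \<xi> (Suc t) \<omega>)) \<omega>
                  = step_mean p q r G (state \<xi> t \<omega>)"
proof -
  interpret sub: sigma_finite_subalgebra M "\<F> t"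
    by (rule sigma_finite_subalgebra_filtration)
  show ?thesis
  proof (rule sub.real_cond_exp_charact)
    fix A assume A: "A \<in> sets (\<F> t)"
    then have A_events: "A \<in> events"
      using subalgebra_filtration by (auto simp: subalgebra_def)
    \<comment> \<open>The part of the integrand that is determined by the past, given that the next step is \<open>e\<close>.\<close>
    define U where "U e \<omega> = indicator A \<omega> * G (advance (state \<xi> t \<omega>) e)" for e \<omega>
    have U_meas: "U e \<in> borel_measurable (\<F> t)" for e
      unfolding U_def using A borel_measurable_state[of "\<lambda>z. G (advance z e)" t] by measurable
    have U_int: "integrable M (U e)" for e
      unfolding U_def using integrable_mult_indicator[OF A_events integrable_state[of "\<lambda>z. G (advance z e)" t]]
      by simp
    let ?I = "\<lambda>e \<omega>. indicator {e} (\<xi> (Suc t) \<omega>) :: real"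
    note UI = integrable_mult_step[OF U_int, of _ _ t]
    have "(LINT \<omega>:A|M. G (state \<xi> (Suc t) \<omega>)) =
      expectation (\<lambda>\<omega>. U 1 \<omega> * ?I 1 \<omega> + U (- 1) \<omega> * ?I (- 1) \<omega> + U 0 \<omega> * ?I 0 \<omega>)"
      unfolding set_lebesgue_integral_def
    proof (rule integral_cong_AE)
      show "(\<lambda>\<omega>. indicat_real A \<omega> *\<^sub>R G (state \<xi> (Suc t) \<omega>)) \<in> borel_measurable M"
        using integrable_mult_indicator[OF A_events integrable_state[of G "Suc t"]] by simp
      show "(\<lambda>\<omega>. U 1 \<omega> * ?I 1 \<omega> + U (- 1) \<omega> * ?I (- 1) \<omega> + U 0 \<omega> * ?I 0 \<omega>) \<in> borel_measurable M"
        by (intro borel_measurable_integrable Bochner_Integration.integrable_add UI)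
      show "AE \<omega> in M. indicat_real A \<omega> *\<^sub>R G (state \<xi> (Suc t) \<omega>) =
          U 1 \<omega> * ?I 1 \<omega> + U (- 1) \<omega> * ?I (- 1) \<omega> + U 0 \<omega> * ?I 0 \<omega>"
        using AE_step_cases[of "Suc t", simplified]
        by eventually_elim (auto simp: U_def state_Suc)
    qed
    also have "\<dots> = expectation (U 1) * p + expectation (U (- 1)) * q + expectation (U 0) * r"
      by (simp add: UI expectation_mult_step U_meas U_int prob_up prob_down prob_stay)
    also have "\<dots> = expectation (\<lambda>\<omega>. U 1 \<omega> * p + U (- 1) \<omega> * q + U 0 \<omega> * r)"
      by (simp add: U_int)
    also have "\<dots> = (LINT \<omega>:A|M. step_mean p q r G (state \<xi> t \<omega>))"
      unfolding set_lebesgue_integral_def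
      by (intro Bochner_Integration.integral_cong) (auto simp: U_def step_mean_def algebra_simps)
    finally show "(LINT \<omega>:A|M. G (state \<xi> (Suc t) \<omega>)) =
        (LINT \<omega>:A|M. step_mean p q r G (state \<xi> t \<omega>))" .
  qed (fact integrable_state borel_measurable_state)+
qed

section \<open>Every point of the domain is visited\<close>

lemma state_eq_in_filtration: "{\<omega> \<in> space M. state \<xi> t \<omega> = z} \<in> sets (\<F> t)"
  using sets_eq_value[OF measurable_state_filtration] by simp

lemma state_eq_in_events: "{\<omega> \<in> space M. state \<xi> t \<omega> = z} \<in> events"
  using state_eq_in_filtration[of t z] subalgebra_filtration by (auto simp: subalgebra_def)

lemma prob_state_advance:
  "prob {\<omega> \<in> space M. state \<xi> (Suc t) \<omega> = advance z e} \<ge>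
   prob {\<omega> \<in> space M. state \<xi> t \<omega> = z} * prob {\<omega> \<in> space M. \<xi> (Suc t) \<omega> = e}"
proof -
  let ?A = "{\<omega> \<in> space M. state \<xi> t \<omega> = z}" and ?B = "{\<omega> \<in> space M. \<xi> (Suc t) \<omega> = e}"
  have "prob ?A * prob ?B = expectation (\<lambda>\<omega>. indicator ?A \<omega> * indicator {e} (\<xi> (Suc t) \<omega>))"
    using state_eq_in_filtration[of t z] state_eq_in_events[of t z]
    by (subst expectation_mult_step)
      (simp_all add: borel_measurable_indicator integrable_real_indicator less_top[symmetric])
  also have "\<dots> = expectation (indicator (?A \<inter> ?B))"
    by (intro Bochner_Integration.integral_cong) (auto simp: indicator_def)
  also have "\<dots> = prob (?A \<inter> ?B)"
    by (simp add: Int_absorb2 subset_eq)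
  also have "\<dots> \<le> prob {\<omega> \<in> space M. state \<xi> (Suc t) \<omega> = advance z e}"
    by (rule finite_measure_mono[OF _ state_eq_in_events]) (auto simp: state_Suc)
  finally show ?thesis .
qed

lemma prob_state_pos: "prob {\<omega> \<in> space M. state \<xi> (n + k) \<omega> = (int n - int k, int n)} > 0"
proof (induction k)
  case 0
  show ?case
  proof (induction n)
    case 0
    then show ?case by (simp add: state_0 prob_space)
  next
    case (Suc n)
    have "0 < prob {\<omega> \<in> space M. state \<xi> n \<omega> = (int n, int n)} * p"
      using Suc p_pos by simp
    also have "\<dots> \<le> prob {\<omega> \<in> space M. state \<xi> (Suc n) \<omega> = advance (int n, int n) 1}"
      using prob_state_advance[of n "(int n, int n)" 1] by (simp add: prob_up)
    finally show ?case
      by (simp add: advance_def max_def add.commute)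
  qed
next
  case (Suc k)
  let ?z = "(int n - int k, int n)"
  have "0 < prob {\<omega> \<in> space M. state \<xi> (n + k) \<omega> = ?z} * q"
    using Suc q_pos by simp
  also have "\<dots> \<le> prob {\<omega> \<in> space M. state \<xi> (Suc (n + k)) \<omega> = advance ?z (- 1)}"
    using prob_state_advance[of "n + k" ?z "- 1"] by (simp add: prob_down)
  finally show ?case
    by (simp add: advance_def max_def algebra_simps)
qed

section \<open>Martingales and harmonic functions\<close>

text \<open>
  Harmonicity is a one-step condition; the tower property extends it to all pairs \<open>s \<le> t\<close>.
\<close>

lemma martingale_state_if_harmonic:
  assumes harm: "\<And>z. z \<in> D \<Longrightarrow> step_mean p q r H z = H z"
  shows "martingale M \<F> (\<lambda>t \<omega>. H (state \<xi> t \<omega>))"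
  unfolding martingale_def
proof (intro conjI allI impI)
  fix s t :: nat assume "s \<le> t"
  interpret S: sigma_finite_subalgebra M "\<F> s"
    by (rule sigma_finite_subalgebra_filtration)
  show "AE \<omega> in M. real_cond_exp M (\<F> s) (\<lambda>\<omega>. H (state \<xi> t \<omega>)) \<omega> = H (state \<xi> s \<omega>)"
    using \<open>s \<le> t\<close>
  proof (induction t rule: dec_induct)
    case base
    show ?case
      by (intro S.real_cond_exp_F_meas integrable_state borel_measurable_state)
  next
    case (step t)
    interpret T: sigma_finite_subalgebra M "\<F> t"
      by (rule sigma_finite_subalgebra_filtration)
    have sub: "subalgebra (\<F> t) (\<F> s)"
      using filtration.sets_F_mono[OF filtration_natural_filtration] step(1) by (simp add: subalgebra_def)
    let ?X = "\<lambda>\<omega>. H (state \<xi> (Suc t) \<omega>)"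
    have one: "AE \<omega> in M. real_cond_exp M (\<F> t) ?X \<omega> = H (state \<xi> t \<omega>)"
      using cond_exp_one_step[of t H] by (simp add: harm state_in_D)
    have "AE \<omega> in M. real_cond_exp M (\<F> s) (real_cond_exp M (\<F> t) ?X) \<omega> = real_cond_exp M (\<F> s) ?X \<omega>"
      by (rule S.real_cond_exp_nested_subalg[OF subalgebra_filtration sub integrable_state])
    moreover have "AE \<omega> in M. real_cond_exp M (\<F> s) (real_cond_exp M (\<F> t) ?X) \<omega>
                            = real_cond_exp M (\<F> s) (\<lambda>\<omega>. H (state \<xi> t \<omega>)) \<omega>"
      by (rule S.real_cond_exp_cong[OF one]) (simp_all add: borel_measurable_integrable integrable_state)
    ultimately show ?case
      using step.IH by eventually_elim simp
  qed
qed (fact filtration_natural_filtration sigma_finite_subalgebra_filtration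
    borel_measurable_state integrable_state)+

text \<open>
  The martingale property is an almost sure statement; it becomes a pointwise equation because no
  point of \<open>D\<close> can be avoided almost surely.
\<close>

lemma harmonic_if_martingale_state:
  assumes mart: "martingale M \<F> (\<lambda>t \<omega>. H (state \<xi> t \<omega>))"
  shows "\<forall>z\<in>D. step_mean p q r H z = H z"
  unfolding ball_D_iff
proof (intro allI, rule ccontr)
  fix n k
  let ?z = "(int n - int k, int n)" and ?t = "n + k"
  assume neq: "step_mean p q r H ?z \<noteq> H ?z"
  have "AE \<omega> in M. real_cond_exp M (\<F> ?t) (\<lambda>\<omega>. H (state \<xi> (Suc ?t) \<omega>)) \<omega> = H (state \<xi> ?t \<omega>)"
    using mart unfolding martingale_def by (meson le_SucI order_refl)
  with cond_exp_one_step[of ?t H] have "AE \<omega> in M. state \<xi> ?t \<omega> \<noteq> ?z"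
    by eventually_elim (use neq in auto)
  then have "prob {\<omega> \<in> space M. state \<xi> ?t \<omega> = ?z} = 0"
    by (subst prob_eq_0[OF state_eq_in_events]) simp
  with prob_state_pos[of n k] show False
    by simp
qed

lemma martingale_state_iff_harmonic:
  "martingale M \<F> (\<lambda>t \<omega>. H (state \<xi> t \<omega>)) \<longleftrightarrow> (\<forall>z\<in>D. step_mean p q r H z = H z)"
  using martingale_state_if_harmonic harmonic_if_martingale_state by blast

end

theorem proposition2:
  fixes P :: "'a measure" and \<xi> :: "nat \<Rightarrow> 'a \<Rightarrow> int"
    and p q r :: real and H :: "int \<times> int \<Rightarrow> real"
  assumes "prob_space P"
    and "p > 0" and "q > 0" and "r \<ge> 0" and "p + q + r = 1"
    and "prob_space.indep_vars P (\<lambda>_. count_space UNIV) \<xi> {1..}"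
    and "\<And>i. i \<ge> 1 \<Longrightarrow> measure P {\<omega> \<in> space P. \<xi> i \<omega> = 1} = p"
    and "\<And>i. i \<ge> 1 \<Longrightarrow> measure P {\<omega> \<in> space P. \<xi> i \<omega> = -1} = q"
    and "\<And>i. i \<ge> 1 \<Longrightarrow> measure P {\<omega> \<in> space P. \<xi> i \<omega> = 0} = r"
  shows "martingale P (natural_filtration P (count_space UNIV) (walk \<xi>))
           (\<lambda>t \<omega>. H (walk \<xi> t \<omega>, walk_max \<xi> t \<omega>)) \<longleftrightarrow>
         (\<exists>F :: nat \<Rightarrow> real. \<forall>(x, y)\<in>D.
            H (x, y) =
              (if p = q
               then F (nat y) - (F (nat (y + 1)) - F (nat y)) * real_of_int (y - x)
               else F (nat y) - (F (nat (y + 1)) - F (nat y)) *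
                      (((q / p) powi (- (y - x)) - 1) / (1 - q / p))))"
proof -
  interpret lazy_walk P \<xi> p q r
    using assms by (intro lazy_walk.intro lazy_walk_axioms.intro) auto
  have closed_form: "(\<forall>(x, y)\<in>D. H (x, y) =
              (if p = q
               then F (nat y) - (F (nat (y + 1)) - F (nat y)) * real_of_int (y - x)
               else F (nat y) - (F (nat (y + 1)) - F (nat y)) *
                      (((q / p) powi (- (y - x)) - 1) / (1 - q / p)))) \<longleftrightarrow>
    (\<forall>n k. H (int n - int k, int n) = F n - (F (Suc n) - F n) * (\<Sum>j=1..k. (p / q) ^ j))"
    for F :: "nat \<Rightarrow> real"
    unfolding ball_D_iff geometric_sum_closed_form[OF \<open>p > 0\<close> \<open>q > 0\<close>]
    by (simp add: nat_add_distrib)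
  show ?thesis
    unfolding closed_form
    using martingale_state_iff_harmonic[of H] harmonic_iff[OF \<open>p > 0\<close> \<open>q > 0\<close> \<open>p + q + r = 1\<close>, of H]
    by (simp add: state_def)
qed

end
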